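(* Let $\mathcal R$ be an expansion of the ordered field of real numbers $(\mathbb{R},<,+,\cdot)$. The following are equivalent: (i) $\mathcal R$ is i-minimal, that is, every subset of $\mathbb{R}$ definable in $\mathcal R$ either has nonempty interior or is nowhere dense; (ii) every subset of $\mathbb{R}$ definable in $\mathcal R$ either has nonempty interior or has Lebesgue measure $0$; (iii) every subset of $\mathbb{R}$ definable in $\mathcal R$ either has nonempty interior or has Hausdorff dimension $0$.
   Context: "Definable" means definable in the first-order structure $\mathcal R$ with parameters from $\mathbb{R}$. *)

theory Defs
  imports "HOL-Analysis.Analysis"
begin

text \<open>One-sorted first-order logic with equality. A language has all elements of \<^typ>\<open>'f\<close> as
  function symbols and all elements of \<^typ>\<open>'r\<close> as relation symbols; arities are part of the
  structure, and constants are function symbols of arity 0. The universe of a structure is the whole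
  type \<^typ>\<open>'a\<close>. Interpretations are only ever consulted on argument lists of the correct length,
  because definability below refers to well-formed formulas only.\<close>

datatype 'f fo_term = Var nat | Fun 'f "'f fo_term list"

datatype ('f, 'r) fo_formula =
    Eq "'f fo_term" "'f fo_term"
  | Rel 'r "'f fo_term list"
  | Neg "('f, 'r) fo_formula"
  | Conj "('f, 'r) fo_formula" "('f, 'r) fo_formula"
  | Ex nat "('f, 'r) fo_formula"

record ('f, 'r, 'a) fo_structure =
  fun_arity :: "'f \<Rightarrow> nat"
  rel_arity :: "'r \<Rightarrow> nat"
  fun_interp :: "'f \<Rightarrow> 'a list \<Rightarrow> 'a"
  rel_interp :: "'r \<Rightarrow> 'a list \<Rightarrow> bool"

primrec wf_term :: "('f, 'r, 'a) fo_structure \<Rightarrow> 'f fo_term \<Rightarrow> bool" where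
  "wf_term M (Var n) \<longleftrightarrow> True"
| "wf_term M (Fun f ts) \<longleftrightarrow> length ts = fun_arity M f \<and> list_all (wf_term M) ts"

primrec wf_formula :: "('f, 'r, 'a) fo_structure \<Rightarrow> ('f, 'r) fo_formula \<Rightarrow> bool" where
  "wf_formula M (Eq s t) \<longleftrightarrow> wf_term M s \<and> wf_term M t"
| "wf_formula M (Rel r ts) \<longleftrightarrow> length ts = rel_arity M r \<and> list_all (wf_term M) ts"
| "wf_formula M (Neg \<phi>) \<longleftrightarrow> wf_formula M \<phi>"
| "wf_formula M (Conj \<phi> \<psi>) \<longleftrightarrow> wf_formula M \<phi> \<and> wf_formula M \<psi>"
| "wf_formula M (Ex n \<phi>) \<longleftrightarrow> wf_formula M \<phi>"

primrec term_val :: "('f, 'r, 'a) fo_structure \<Rightarrow> (nat \<Rightarrow> 'a) \<Rightarrow> 'f fo_term \<Rightarrow> 'a" where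
  "term_val M v (Var n) = v n"
| "term_val M v (Fun f ts) = fun_interp M f (map (term_val M v) ts)"

primrec sat :: "('f, 'r, 'a) fo_structure \<Rightarrow> (nat \<Rightarrow> 'a) \<Rightarrow> ('f, 'r) fo_formula \<Rightarrow> bool" where
  "sat M v (Eq s t) \<longleftrightarrow> term_val M v s = term_val M v t"
| "sat M v (Rel r ts) \<longleftrightarrow> rel_interp M r (map (term_val M v) ts)"
| "sat M v (Neg \<phi>) \<longleftrightarrow> \<not> sat M v \<phi>"
| "sat M v (Conj \<phi> \<psi>) \<longleftrightarrow> sat M v \<phi> \<and> sat M v \<psi>"
| "sat M v (Ex n \<phi>) \<longleftrightarrow> (\<exists>a. sat M (v(n := a)) \<phi>)"

text \<open>Definability of subsets of the universe, with parameters: variable 0 is the free variable,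
  and the assignment \<open>v\<close> supplies the parameters for the remaining free variables.\<close>

definition definable :: "('f, 'r, 'a) fo_structure \<Rightarrow> 'a set \<Rightarrow> bool" where
  "definable M S \<longleftrightarrow> (\<exists>\<phi> v. wf_formula M \<phi> \<and> S = {x. sat M (v(0 := x)) \<phi>})"

definition expands_real_field :: "('f, 'r, real) fo_structure \<Rightarrow> bool" where
  "expands_real_field M \<longleftrightarrow>
     (\<exists>l. rel_arity M l = 2 \<and> (\<forall>x y. rel_interp M l [x, y] \<longleftrightarrow> x < y)) \<and>
     (\<exists>p. fun_arity M p = 2 \<and> (\<forall>x y. fun_interp M p [x, y] = x + y)) \<and>
     (\<exists>t. fun_arity M t = 2 \<and> (\<forall>x y. fun_interp M t [x, y] = x * y))"

definition nowhere_dense :: "'a::topological_space set \<Rightarrow> bool" where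
  "nowhere_dense S \<longleftrightarrow> interior (closure S) = {}"

definition i_minimal :: "('f, 'r, real) fo_structure \<Rightarrow> bool" where
  "i_minimal M \<longleftrightarrow> (\<forall>S. definable M S \<longrightarrow> interior S \<noteq> {} \<or> nowhere_dense S)"

text \<open>The \<open>s\<close>-th power of the diameter, with the convention that for \<open>s = 0\<close> a nonempty set
  contributes 1 (note that \<open>0 powr 0 = 0\<close>) and the empty set always contributes 0.\<close>

definition diam_power :: "real \<Rightarrow> 'a::metric_space set \<Rightarrow> ennreal" where
  "diam_power s U = (if U = {} then 0 else if s = 0 then 1 else ennreal (diameter U powr s))"

text \<open>Boundedness is required explicitly because \<^const>\<open>diameter\<close> is real-valued and
  unspecified on unbounded sets.\<close>

definition hausdorff_premeasure :: "real \<Rightarrow> real \<Rightarrow> 'a::metric_space set \<Rightarrow> ennreal" where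
  "hausdorff_premeasure s \<delta> A =
     (INF U \<in> {U :: nat \<Rightarrow> 'a set. A \<subseteq> (\<Union>i. U i) \<and> (\<forall>i. bounded (U i) \<and> diameter (U i) \<le> \<delta>)}.
        \<Sum>i. diam_power s (U i))"

definition hausdorff_measure :: "real \<Rightarrow> 'a::metric_space set \<Rightarrow> ennreal" where
  "hausdorff_measure s A = (SUP \<delta> \<in> {0<..}. hausdorff_premeasure s \<delta> A)"

text \<open>The empty set has dimension 0 under this definition.\<close>

definition hausdorff_dim :: "'a::metric_space set \<Rightarrow> ennreal" where
  "hausdorff_dim A = Inf {ennreal s | s. 0 \<le> s \<and> hausdorff_measure s A = 0}"

end

theory Submission
  imports Defs
begin

text \<open>If a definable set without interior were dense in an interval, it and its complement in
  the interval would both have empty interior, hence both be null. Sets of Hausdorff dimension 0 are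
  null. The substantial step starts from an i-minimal structure and a compact definable set \<open>K\<close>
  without interior. The points of \<open>K\<close> isolated from the left form a countable definable set \<open>D\<close>
  that is dense in \<open>K\<close>. Definable images of \<open>D\<close> are again countable, hence nowhere dense. In
  particular some \<open>t\<close> lies at positive distance from all quotients \<open>(a - b) / (c - d)\<close> of
  differences from \<open>D\<close>, so that \<open>(a, b) \<mapsto> a - t b\<close> maps \<open>r\<close>-separated subsets of \<open>D \<times> D\<close>
  injectively to \<open>\<epsilon> r\<close>-separated subsets of a bounded countable definable set. Iterating \<open>k\<close> times
  shows that \<open>r\<close>-separated subsets of \<open>D\<close> have at most \<open>(C / r) powr (1 / 2 ^ k)\<close> elements. As \<open>k\<close>
  is arbitrary, the closure of \<open>D\<close> has Hausdorff dimension 0.\<close>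

section \<open>Left-isolated points\<close>

definition left_isolated :: "'a::linorder set \<Rightarrow> 'a set" where
  "left_isolated S = {x \<in> S. \<exists>y<x. {y<..<x} \<inter> S = {}}"

lemma left_isolated_subset: "left_isolated S \<subseteq> S"
  by (auto simp: left_isolated_def)

lemma countable_left_isolated:
  fixes S :: "'a::{linorder_topology, second_countable_topology} set"
  shows "countable (left_isolated S)"
proof -
  obtain B :: "'a set" where B: "countable B" "\<And>x y. x < y \<Longrightarrow> \<exists>b\<in>B. x < b \<and> b \<le> y"
    using countable_separating_set_linorder1 by blast
  have "\<exists>y b. {y<..<x} \<inter> S = {} \<and> b \<in> B \<and> y < b \<and> b \<le> x" if "x \<in> left_isolated S" for x
    using that B(2) unfolding left_isolated_def by blast
  then obtain y b where gap: "\<And>x. x \<in> left_isolated S \<Longrightarrow>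
      {y x<..<x} \<inter> S = {} \<and> b x \<in> B \<and> y x < b x \<and> b x \<le> x"
    by metis
  have "strict_mono_on (left_isolated S) b"
  proof (rule strict_mono_onI)
    fix x x' assume x: "x \<in> left_isolated S" "x' \<in> left_isolated S" "x < x'"
    then have "x \<notin> {y x'<..<x'}" using gap[OF x(2)] left_isolated_subset by blast
    then have "x \<le> y x'" using x(3) by simp
    then show "b x < b x'" using gap[OF x(1)] gap[OF x(2)] by (meson le_less_trans)
  qed
  then have "inj_on b (left_isolated S)" by (rule strict_mono_on_imp_inj_on)
  moreover have "countable (b ` left_isolated S)"
    using gap by (intro countable_subset[OF _ B(1)]) auto
  ultimately show ?thesis by (rule countable_image_inj_on[rotated])
qed

lemma closed_subset_closure_left_isolated:
  fixes S :: "real set"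
  assumes "closed S" "interior S = {}"
  shows "S \<subseteq> closure (left_isolated S)"
proof
  fix x assume x: "x \<in> S"
  have "\<exists>z\<in>left_isolated S. dist z x < e" if "0 < e" for e
  proof -
    have "\<not> {x - e<..<x} \<subseteq> S"
      using interior_maximal[of "{x - e<..<x}" S] assms(2) that by auto
    then obtain y where y: "x - e < y" "y < x" "y \<notin> S"
      unfolding subset_iff greaterThanLessThan_iff by blast
    define z where "z = Inf (S \<inter> {y..})"
    have bdd: "bdd_below (S \<inter> {y..})" by (rule bdd_belowI[of _ y]) auto
    have "z \<in> S \<inter> {y..}"
      unfolding z_def using bdd x y assms(1)
      by (intro closed_contains_Inf closed_Int closed_atLeast) auto
    moreover have "{y<..<z} \<inter> S = {}"
      using cInf_lower[OF _ bdd] unfolding z_def by force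
    ultimately have "z \<in> left_isolated S"
      using y(3) unfolding left_isolated_def by (auto simp: order.strict_iff_order)
    moreover have "z \<le> x" unfolding z_def using bdd x y by (intro cInf_lower) auto
    ultimately show ?thesis
      using \<open>z \<in> S \<inter> {y..}\<close> y by (intro bexI[of _ z]) (auto simp: dist_real_def)
  qed
  then show "x \<in> closure (left_isolated S)" by (simp add: closure_approachable)
qed

section \<open>Packing numbers\<close>

definition separated :: "real \<Rightarrow> 'a::metric_space set \<Rightarrow> bool" where
  "separated r F \<longleftrightarrow> pairwise (\<lambda>x y. r \<le> dist x y) F"

text \<open>For \<open>m > 0\<close>: the \<open>r\<close>-packing numbers of \<open>D\<close> are \<open>O(r powr (- 1 / m))\<close> as \<open>r\<close> tends
  to 0. In particular the upper box dimension of \<open>D\<close> is at most \<open>1 / m\<close>.\<close>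

definition packing_bounded :: "nat \<Rightarrow> 'a::metric_space set \<Rightarrow> bool" where
  "packing_bounded m D \<longleftrightarrow> (\<exists>C. \<forall>r F. 0 < r \<and> r \<le> 1 \<and> F \<subseteq> D \<and> finite F \<and> separated r F \<longrightarrow>
     real (card F) ^ m * r \<le> C)"

lemma packing_boundedI:
  assumes "\<And>r F. 0 < r \<Longrightarrow> r \<le> 1 \<Longrightarrow> F \<subseteq> D \<Longrightarrow> finite F \<Longrightarrow> separated r F \<Longrightarrow>
    real (card F) ^ m * r \<le> C"
  shows "packing_bounded m D"
  using assms unfolding packing_bounded_def by blast

lemma packing_boundedE:
  assumes "packing_bounded m D"
  obtains C where "\<And>r F. 0 < r \<Longrightarrow> r \<le> 1 \<Longrightarrow> F \<subseteq> D \<Longrightarrow> finite F \<Longrightarrow> separated r F \<Longrightarrow>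
    real (card F) ^ m * r \<le> C"
  using assms unfolding packing_bounded_def by blast

lemma card_separated_le:
  fixes F :: "real set"
  assumes "finite F" "separated r F" "F \<subseteq> {a..b}" "a \<le> b" "0 \<le> r"
  shows "real (card F) * r \<le> b - a + r"
  using assms
proof (induction F arbitrary: b rule: finite_linorder_max_induct)
  case empty
  then show ?case by simp
next
  case (insert x F)
  show ?case
  proof (cases "F = {}")
    case True
    then show ?thesis using insert.prems by simp
  next
    case False
    have "y \<le> x - r" if "y \<in> F" for y
      using insert.prems(1) insert.hyps(2) that
      by (force simp: separated_def pairwise_insert dist_real_def)
    then have F: "F \<subseteq> {a..x - r}" using insert.prems(2) by auto
    moreover have "separated r F" using insert.prems(1) by (simp add: separated_def pairwise_insert)
    moreover have "a \<le> x - r" using F False by force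
    ultimately have "real (card F) * r \<le> x - r - a + r" using insert.IH insert.prems by blast
    moreover have "x \<le> b" using insert.prems by auto
    moreover have "x \<notin> F" using insert.hyps(2) by blast
    ultimately show ?thesis using insert.hyps(1) by (simp add: algebra_simps)
  qed
qed

lemma packing_bounded_1:
  fixes D :: "real set"
  assumes "bounded D"
  shows "packing_bounded 1 D"
proof -
  obtain a where D: "D \<subseteq> {- a..a}" using bounded_subset_cbox_symmetric[OF assms] by auto
  show ?thesis
  proof (rule packing_boundedI)
    fix r F assume r: "0 < r" "r \<le> 1" and F: "F \<subseteq> D" "finite F" "separated r F"
    have in_interval: "F \<subseteq> {- \<bar>a\<bar>..\<bar>a\<bar>}" using F(1) D by auto
    then have "real (card F) * r \<le> \<bar>a\<bar> - (- \<bar>a\<bar>) + r"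
      using card_separated_le[OF F(2,3) in_interval] r by simp
    with r show "real (card F) ^ 1 * r \<le> 2 * \<bar>a\<bar> + 1" by simp
  qed
qed

lemma packing_bounded_expanding_image:
  assumes "packing_bounded m (g ` D)"
    and expanding: "\<And>x y. x \<in> D \<Longrightarrow> y \<in> D \<Longrightarrow> dist x y \<le> L * dist (g x) (g y)"
  shows "packing_bounded m D"
proof -
  obtain C where C: "\<And>r F. 0 < r \<Longrightarrow> r \<le> 1 \<Longrightarrow> F \<subseteq> g ` D \<Longrightarrow> finite F \<Longrightarrow> separated r F \<Longrightarrow>
      real (card F) ^ m * r \<le> C"
    using packing_boundedE[OF assms(1)] by blast
  define K where "K = max L 1"
  have "1 \<le> K" by (simp add: K_def)
  have dist_le: "dist x y \<le> K * dist (g x) (g y)" if "x \<in> D" "y \<in> D" for x y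
    using expanding[OF that] mult_right_mono[of L K "dist (g x) (g y)"] by (auto simp: K_def)
  show ?thesis
  proof (rule packing_boundedI)
    fix r F assume r: "0 < r" "r \<le> 1" and F: "F \<subseteq> D" "finite F" "separated r F"
    have far: "r / K \<le> dist (g x) (g y)" if "x \<in> F" "y \<in> F" "x \<noteq> y" for x y
    proof -
      have "r \<le> dist x y" using F(3) that by (simp add: separated_def pairwise_def)
      also have "\<dots> \<le> K * dist (g x) (g y)" using dist_le that F(1) by blast
      finally show ?thesis using \<open>1 \<le> K\<close> by (simp add: divide_le_eq mult.commute)
    qed
    have "inj_on g F"
    proof (rule inj_onI, rule ccontr)
      fix x y assume "x \<in> F" "y \<in> F" "g x = g y" "x \<noteq> y"
      then have "r / K \<le> 0" using far[of x y] by simp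
      with r \<open>1 \<le> K\<close> show False by (simp add: divide_le_0_iff)
    qed
    then have "card (g ` F) = card F" by (rule card_image)
    moreover have "separated (r / K) (g ` F)"
      unfolding separated_def by (rule pairwise_imageI) (rule far)
    then have "real (card (g ` F)) ^ m * (r / K) \<le> C"
      using r F \<open>1 \<le> K\<close> by (intro C) auto
    ultimately show "real (card F) ^ m * r \<le> C * K" using \<open>1 \<le> K\<close> by (simp add: field_simps)
  qed
qed

lemma packing_bounded_square:
  assumes "packing_bounded m (D \<times> D)"
  shows "packing_bounded (2 * m) D"
proof -
  obtain C where C: "\<And>r F. 0 < r \<Longrightarrow> r \<le> 1 \<Longrightarrow> F \<subseteq> D \<times> D \<Longrightarrow> finite F \<Longrightarrow> separated r F \<Longrightarrow>
      real (card F) ^ m * r \<le> C"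
    using packing_boundedE[OF assms] by blast
  show ?thesis
  proof (rule packing_boundedI)
    fix r F assume r: "0 < r" "r \<le> 1" and F: "F \<subseteq> D" "finite F" "separated r F"
    have "r \<le> dist p q" if "p \<in> F \<times> F" "q \<in> F \<times> F" "p \<noteq> q" for p q
    proof -
      have "r \<le> dist (fst p) (fst q) \<or> r \<le> dist (snd p) (snd q)"
        using that F(3) unfolding separated_def pairwise_def by (auto simp: prod_eq_iff)
      then show ?thesis using dist_fst_le[of p q] dist_snd_le[of p q] by linarith
    qed
    then have "separated r (F \<times> F)" by (simp add: separated_def pairwise_def)
    then have "real (card (F \<times> F)) ^ m * r \<le> C" using r F by (intro C) auto
    then show "real (card F) ^ (2 * m) * r \<le> C"
      by (simp add: card_cartesian_product power_mult power2_eq_square)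
  qed
qed

lemma separated_cball_cover:
  assumes "\<And>F. F \<subseteq> D \<Longrightarrow> finite F \<Longrightarrow> separated r F \<Longrightarrow> card F \<le> b" "0 \<le> r"
  obtains F where "F \<subseteq> D" "finite F" "separated r F" "D \<subseteq> (\<Union>x\<in>F. cball x r)"
proof -
  let ?P = "\<lambda>F. F \<subseteq> D \<and> finite F \<and> separated r F"
  have "?P {}" by (simp add: separated_def)
  then obtain F where F: "?P F" and maximal: "\<And>G. ?P G \<Longrightarrow> card G \<le> card F"
    using ex_has_greatest_nat[of ?P "{}" card "Suc b"] assms(1) by (auto simp: less_Suc_eq_le)
  have "x \<in> (\<Union>y\<in>F. cball y r)" if "x \<in> D" for x
  proof (rule ccontr)
    assume "x \<notin> (\<Union>y\<in>F. cball y r)"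
    then have far: "r < dist y x" if "y \<in> F" for y using that by auto
    then have "?P (insert x F)"
      using F \<open>x \<in> D\<close> by (force simp: separated_def pairwise_insert dist_commute)
    then have "card (insert x F) \<le> card F" by (rule maximal)
    moreover have "x \<notin> F" using far[of x] assms(2) by auto
    ultimately show False using F by simp
  qed
  with F show ?thesis using that by blast
qed

lemma packing_bounded_finite_cover:
  assumes "packing_bounded m D" "0 < m"
  obtains C where "\<And>r. 0 < r \<Longrightarrow> r \<le> 1 \<Longrightarrow>
    \<exists>F. finite F \<and> D \<subseteq> (\<Union>x\<in>F. cball x r) \<and> real (card F) ^ m * r \<le> C"
proof -
  obtain C where C: "\<And>r F. 0 < r \<Longrightarrow> r \<le> 1 \<Longrightarrow> F \<subseteq> D \<Longrightarrow> finite F \<Longrightarrow> separated r F \<Longrightarrow>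
      real (card F) ^ m * r \<le> C"
    using packing_boundedE[OF assms(1)] by blast
  show ?thesis
  proof (rule that)
    fix r :: real assume r: "0 < r" "r \<le> 1"
    have "card F \<le> nat \<lfloor>C / r\<rfloor>" if "F \<subseteq> D" "finite F" "separated r F" for F
    proof -
      have "real (card F) \<le> real (card F) ^ m"
        using assms(2) by (cases "card F = 0") (auto intro!: self_le_power)
      also have "\<dots> \<le> C / r" using C[OF r that] r(1) by (simp add: pos_le_divide_eq)
      finally show ?thesis by linarith
    qed
    then obtain F where "F \<subseteq> D" "finite F" "separated r F" "D \<subseteq> (\<Union>x\<in>F. cball x r)"
      by (rule separated_cball_cover[OF _ less_imp_le[OF r(1)]])
    then show "\<exists>F. finite F \<and> D \<subseteq> (\<Union>x\<in>F. cball x r) \<and> real (card F) ^ m * r \<le> C"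
      using C[OF r] by blast
  qed
qed

section \<open>Difference quotients\<close>

definition difference_quotients :: "'a::field set \<Rightarrow> 'a set" where
  "difference_quotients D = {q. \<exists>a\<in>D. \<exists>b\<in>D. \<exists>c\<in>D. \<exists>d\<in>D. c \<noteq> d \<and> q = (a - b) / (c - d)}"

lemma countable_difference_quotients:
  assumes "countable D"
  shows "countable (difference_quotients D)"
proof (rule countable_subset)
  show "difference_quotients D \<subseteq> (\<lambda>(a, b, c, d). (a - b) / (c - d)) ` (D \<times> D \<times> D \<times> D)"
    by (force simp: difference_quotients_def)
qed (use assms in auto)

lemma bounded_image_diff_scaled:
  fixes D :: "'a::real_normed_algebra set"
  assumes "bounded D"
  shows "bounded ((\<lambda>(a, b). a - t * b) ` (D \<times> D))"
proof -
  have "bounded_linear (\<lambda>p. fst p - t * snd p)"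
    by (intro bounded_linear_intros)
  then show ?thesis
    unfolding case_prod_unfold using assms by (intro bounded_linear_image bounded_Times)
qed

lemma dist_le_dist_diff_scaled:
  fixes D :: "real set"
  assumes "0 < e" "\<And>q. q \<in> difference_quotients D \<Longrightarrow> e \<le> \<bar>q - t\<bar>"
    and "a \<in> D" "b \<in> D" "a' \<in> D" "b' \<in> D"
  shows "dist (a, b) (a', b') \<le> (1 + (\<bar>t\<bar> + 1) / e) * dist (a - t * b) (a' - t * b')"
proof -
  define w where "w = (a - a') - t * (b - b')"
  have "e * \<bar>b - b'\<bar> \<le> \<bar>w\<bar>"
  proof (cases "b = b'")
    case False
    then have "(a - a') / (b - b') \<in> difference_quotients D"
      using assms(3-6) by (auto simp: difference_quotients_def)
    then have "e * \<bar>b - b'\<bar> \<le> \<bar>(a - a') / (b - b') - t\<bar> * \<bar>b - b'\<bar>"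
      by (intro mult_right_mono assms(2)) auto
    also have "\<dots> = \<bar>w\<bar>" using False by (simp add: w_def field_simps flip: abs_mult)
    finally show ?thesis .
  qed simp
  then have "\<bar>b - b'\<bar> \<le> \<bar>w\<bar> / e" using assms(1) by (simp add: pos_le_divide_eq mult.commute)
  then have "(\<bar>t\<bar> + 1) * \<bar>b - b'\<bar> \<le> (\<bar>t\<bar> + 1) * (\<bar>w\<bar> / e)" by (intro mult_left_mono) auto
  moreover have "\<bar>a - a'\<bar> \<le> \<bar>w\<bar> + \<bar>t\<bar> * \<bar>b - b'\<bar>"
    unfolding w_def by (simp flip: abs_mult)
  moreover have "dist (a, b) (a', b') \<le> \<bar>a - a'\<bar> + \<bar>b - b'\<bar>"
    using sqrt_sum_squares_le_sum_abs by (simp add: dist_Pair_Pair dist_real_def)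
  ultimately have "dist (a, b) (a', b') \<le> (1 + (\<bar>t\<bar> + 1) / e) * \<bar>w\<bar>"
    by (simp add: algebra_simps)
  also have "\<bar>w\<bar> = dist (a - t * b) (a' - t * b')"
    by (simp add: w_def dist_real_def algebra_simps)
  finally show ?thesis .
qed

lemma packing_bounded_double:
  fixes D :: "real set"
  assumes "t \<notin> closure (difference_quotients D)"
    and "packing_bounded m ((\<lambda>(a, b). a - t * b) ` (D \<times> D))"
  shows "packing_bounded (2 * m) D"
proof -
  obtain e where e: "0 < e" "\<And>q. q \<in> difference_quotients D \<Longrightarrow> e \<le> \<bar>q - t\<bar>"
    using assms(1) by (auto simp: closure_approachable dist_real_def not_less)
  have "dist p q \<le> (1 + (\<bar>t\<bar> + 1) / e) *
      dist ((\<lambda>(a, b). a - t * b) p) ((\<lambda>(a, b). a - t * b) q)"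
    if "p \<in> D \<times> D" "q \<in> D \<times> D" for p q
    using that dist_le_dist_diff_scaled[OF e] by auto
  then have "packing_bounded m (D \<times> D)"
    by (rule packing_bounded_expanding_image[OF assms(2)])
  then show ?thesis by (rule packing_bounded_square)
qed

section \<open>Hausdorff measure\<close>

lemma hausdorff_premeasure_le:
  assumes "A \<subseteq> (\<Union>i::nat. U i)" "\<And>i. bounded (U i)" "\<And>i. diameter (U i) \<le> \<delta>"
  shows "hausdorff_premeasure s \<delta> A \<le> (\<Sum>i. diam_power s (U i))"
  unfolding hausdorff_premeasure_def using assms by (intro INF_lower) auto

lemma hausdorff_premeasure_less_cover:
  assumes "hausdorff_premeasure s \<delta> A < c"
  obtains U :: "nat \<Rightarrow> 'a::metric_space set" where "A \<subseteq> (\<Union>i. U i)" "\<And>i. bounded (U i)"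
    "\<And>i. diameter (U i) \<le> \<delta>" "(\<Sum>i. diam_power s (U i)) < c"
  using assms unfolding hausdorff_premeasure_def INF_less_iff by blast

lemma hausdorff_premeasure_mono:
  "A \<subseteq> B \<Longrightarrow> hausdorff_premeasure s \<delta> A \<le> hausdorff_premeasure s \<delta> B"
  unfolding hausdorff_premeasure_def by (rule INF_superset_mono) auto

lemma hausdorff_premeasure_le_measure:
  "0 < \<delta> \<Longrightarrow> hausdorff_premeasure s \<delta> A \<le> hausdorff_measure s A"
  unfolding hausdorff_measure_def by (intro SUP_upper) auto

lemma hausdorff_measure_le:
  "(\<And>\<delta>. 0 < \<delta> \<Longrightarrow> hausdorff_premeasure s \<delta> A \<le> c) \<Longrightarrow> hausdorff_measure s A \<le> c"
  unfolding hausdorff_measure_def by (intro SUP_least) auto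

lemma hausdorff_measure_mono: "A \<subseteq> B \<Longrightarrow> hausdorff_measure s A \<le> hausdorff_measure s B"
  unfolding hausdorff_measure_def by (intro SUP_mono) (auto intro: hausdorff_premeasure_mono)

lemma hausdorff_premeasure_UN_le_covers:
  fixes U :: "nat \<Rightarrow> nat \<Rightarrow> 'a::metric_space set"
  assumes "\<And>n. A n \<subseteq> (\<Union>i. U n i)" "\<And>n i. bounded (U n i)" "\<And>n i. diameter (U n i) \<le> \<delta>"
  shows "hausdorff_premeasure s \<delta> (\<Union>n. A n) \<le> (\<Sum>n. \<Sum>i. diam_power s (U n i))"
proof -
  define V where "V = case_prod U \<circ> prod_decode"
  have "hausdorff_premeasure s \<delta> (\<Union>n. A n) \<le> (\<Sum>i. diam_power s (V i))"
  proof (rule hausdorff_premeasure_le)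
    have "U n i \<subseteq> (\<Union>j. V j)" for n i
      using UN_upper[of "prod_encode (n, i)" UNIV V] by (simp add: V_def)
    then show "(\<Union>n. A n) \<subseteq> (\<Union>j. V j)"
      by (intro UN_least order_trans[OF assms(1)])
  qed (use assms(2,3) in \<open>simp_all add: V_def split: prod.split\<close>)
  also have "\<dots> = (\<Sum>i. (\<lambda>(n, m). diam_power s (U n m)) (prod_decode i))"
    by (simp add: V_def case_prod_unfold)
  also have "\<dots> = (\<Sum>n. \<Sum>i. diam_power s (U n i))"
    by (rule suminf_ennreal_2dimen) simp
  finally show ?thesis .
qed

lemma hausdorff_premeasure_UN_le:
  fixes A :: "nat \<Rightarrow> 'a::metric_space set"
  shows "hausdorff_premeasure s \<delta> (\<Union>n. A n) \<le> (\<Sum>n. hausdorff_premeasure s \<delta> (A n))"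
proof (rule ennreal_le_epsilon)
  fix e :: real
  assume finite: "(\<Sum>n. hausdorff_premeasure s \<delta> (A n)) < top" and "0 < e"
  let ?c = "\<lambda>n. hausdorff_premeasure s \<delta> (A n) + ennreal (e * (1 / 2) ^ Suc n)"
  have "\<exists>U. A n \<subseteq> (\<Union>i::nat. U i) \<and> (\<forall>i. bounded (U i)) \<and> (\<forall>i. diameter (U i) \<le> \<delta>) \<and>
      (\<Sum>i. diam_power s (U i)) < ?c n" for n
  proof -
    have "hausdorff_premeasure s \<delta> (A n) < ?c n"
      using ennreal_suminf_lessD[OF finite, of n] \<open>0 < e\<close>
        ennreal_add_left_cancel_less[of "hausdorff_premeasure s \<delta> (A n)" 0] by simp
    then show ?thesis by (rule hausdorff_premeasure_less_cover) blast
  qed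
  then obtain U where U: "\<And>n. A n \<subseteq> (\<Union>i::nat. U n i)"
      "\<And>n i. bounded (U n i)" "\<And>n i. diameter (U n i) \<le> \<delta>"
      "\<And>n. (\<Sum>i. diam_power s (U n i)) < ?c n"
    by metis
  have "hausdorff_premeasure s \<delta> (\<Union>n. A n) \<le> (\<Sum>n. \<Sum>i. diam_power s (U n i))"
    using U(1-3) by (rule hausdorff_premeasure_UN_le_covers)
  also have "\<dots> \<le> (\<Sum>n. ?c n)"
    using U(4) by (intro suminf_le) (auto intro: less_imp_le)
  also have "\<dots> = (\<Sum>n. hausdorff_premeasure s \<delta> (A n)) + (\<Sum>n. ennreal (e * (1 / 2) ^ Suc n))"
    by (rule suminf_add[symmetric]) auto
  also have "(\<Sum>n. ennreal (e * (1 / 2) ^ Suc n)) = ennreal (e * 1)"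
    using \<open>0 < e\<close> by (intro suminf_ennreal_eq sums_mult power_half_series) auto
  finally show "hausdorff_premeasure s \<delta> (\<Union>n. A n) \<le>
      (\<Sum>n. hausdorff_premeasure s \<delta> (A n)) + ennreal e"
    by simp
qed

lemma hausdorff_measure_UN_le:
  fixes A :: "nat \<Rightarrow> 'a::metric_space set"
  shows "hausdorff_measure s (\<Union>n. A n) \<le> (\<Sum>n. hausdorff_measure s (A n))"
proof (rule hausdorff_measure_le)
  fix \<delta> :: real assume "0 < \<delta>"
  have "hausdorff_premeasure s \<delta> (\<Union>n. A n) \<le> (\<Sum>n. hausdorff_premeasure s \<delta> (A n))"
    by (rule hausdorff_premeasure_UN_le)
  also have "\<dots> \<le> (\<Sum>n. hausdorff_measure s (A n))"
    using \<open>0 < \<delta>\<close> by (intro suminf_le hausdorff_premeasure_le_measure) auto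
  finally show "hausdorff_premeasure s \<delta> (\<Union>n. A n) \<le> (\<Sum>n. hausdorff_measure s (A n))" .
qed

lemma diameter_cball_le:
  fixes x :: "'a::metric_space"
  assumes "0 \<le> r"
  shows "diameter (cball x r) \<le> 2 * r"
proof -
  have "dist y z \<le> 2 * r" if "y \<in> cball x r" "z \<in> cball x r" for y z
    using that dist_triangle3[of y z x] by simp
  then show ?thesis
    unfolding diameter_def using assms by (auto intro!: cSUP_least simp del: mem_cball)
qed

lemma hausdorff_premeasure_finite_cball_cover:
  fixes A :: "'a::metric_space set"
  assumes "finite F" "A \<subseteq> (\<Union>x\<in>F. cball x r)" "0 \<le> r" "2 * r \<le> \<delta>" "0 < s"
  shows "hausdorff_premeasure s \<delta> A \<le> ennreal (real (card F) * (2 * r) powr s)"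
proof -
  obtain h where h: "bij_betw h {..<card F} F"
    using ex_bij_betw_nat_finite[OF assms(1)] by (auto simp: atLeast0LessThan)
  define U where "U i = (if i < card F then cball (h i) r else {})" for i
  have "hausdorff_premeasure s \<delta> A \<le> (\<Sum>i. diam_power s (U i))"
  proof (rule hausdorff_premeasure_le)
    have "(\<Union>i. U i) = (\<Union>x\<in>h ` {..<card F}. cball x r)"
      by (auto simp: U_def split: if_splits)
    then show "A \<subseteq> (\<Union>i. U i)" using assms(2) h by (simp add: bij_betw_imp_surj_on)
    show "diameter (U i) \<le> \<delta>" for i
      using order_trans[OF diameter_cball_le[of r "h i"] assms(4)] assms(3,4) by (simp add: U_def)
  qed (simp add: U_def)
  also have "\<dots> = (\<Sum>i<card F. diam_power s (U i))"
    by (rule suminf_finite) (auto simp: U_def diam_power_def)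
  also have "\<dots> \<le> (\<Sum>i<card F. ennreal ((2 * r) powr s))"
    using assms(3,5) diameter_cball_le[of r]
    by (intro sum_mono)
      (auto simp: U_def diam_power_def intro!: ennreal_leI powr_mono2 diameter_ge_0)
  also have "\<dots> = ennreal (real (card F) * (2 * r) powr s)"
    by (simp add: ennreal_mult ennreal_of_nat_eq_real_of_nat)
  finally show ?thesis .
qed

lemma packing_bounded_hausdorff_premeasure_le:
  assumes "packing_bounded m D" "0 < m" "0 < s"
  obtains C where "\<And>r \<delta>. 0 < r \<Longrightarrow> r \<le> 1 \<Longrightarrow> 2 * r \<le> \<delta> \<Longrightarrow>
    hausdorff_premeasure s \<delta> (closure D) \<le> ennreal (root m (C * r powr (s * m - 1)))"
proof -
  obtain C where cover: "\<And>r. 0 < r \<Longrightarrow> r \<le> 1 \<Longrightarrow>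
      \<exists>F. finite F \<and> D \<subseteq> (\<Union>x\<in>F. cball x r) \<and> real (card F) ^ m * r \<le> C"
    using packing_bounded_finite_cover[OF assms(1,2)] by blast
  show ?thesis
  proof (rule that)
    fix r \<delta> :: real assume r: "0 < r" "r \<le> 1" "2 * r \<le> \<delta>"
    obtain F where F: "finite F" "D \<subseteq> (\<Union>x\<in>F. cball x r)" "real (card F) ^ m * r \<le> C"
      using cover[OF r(1,2)] by blast
    have "closure D \<subseteq> (\<Union>x\<in>F. cball x r)"
      using F(1,2) by (intro closure_minimal) auto
    then have "hausdorff_premeasure s \<delta> (closure D) \<le> ennreal (real (card F) * (2 * r) powr s)"
      using F(1) r assms(3) by (intro hausdorff_premeasure_finite_cball_cover) auto
    also have "\<dots> \<le> ennreal (root m (C * 2 powr (s * m) * r powr (s * m - 1)))"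
    proof (rule ennreal_leI)
      have "(real (card F) * (2 * r) powr s) ^ m =
          (real (card F) ^ m * r) * ((2 * r) powr (s * m) / r)"
        using r(1) by (simp add: power_mult_distrib powr_power mult.commute)
      also have "\<dots> \<le> C * ((2 * r) powr (s * m) / r)"
        using F(3) r(1) by (intro mult_right_mono) auto
      also have "\<dots> = C * 2 powr (s * m) * r powr (s * m - 1)"
        using r(1) by (simp add: powr_mult powr_diff)
      finally have "root m ((real (card F) * (2 * r) powr s) ^ m) \<le>
          root m (C * 2 powr (s * m) * r powr (s * m - 1))"
        by (rule real_root_le_mono[OF assms(2)])
      then show "real (card F) * (2 * r) powr s \<le>
          root m (C * 2 powr (s * m) * r powr (s * m - 1))"
        using assms(2) by (simp add: real_root_power_cancel)
    qed
    finally show "hausdorff_premeasure s \<delta> (closure D) \<le>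
        ennreal (root m (C * 2 powr (s * m) * r powr (s * m - 1)))" .
  qed
qed

lemma packing_bounded_imp_hausdorff_measure_closure_eq_0:
  assumes "packing_bounded m D" "1 < s * real m"
  shows "hausdorff_measure s (closure D) = 0"
proof -
  have "0 < m" using assms(2) by (cases m) auto
  then have "0 < s" using assms(2) zero_less_mult_pos2[of s "real m"] by simp
  obtain C where C: "\<And>r \<delta>. 0 < r \<Longrightarrow> r \<le> 1 \<Longrightarrow> 2 * r \<le> \<delta> \<Longrightarrow>
    hausdorff_premeasure s \<delta> (closure D) \<le> ennreal (root m (C * r powr (s * m - 1)))"
    using packing_bounded_hausdorff_premeasure_le[OF assms(1) \<open>0 < m\<close> \<open>0 < s\<close>] by blast
  have "((\<lambda>r. r powr (s * m - 1)) \<longlongrightarrow> 0) (at_right 0)"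
  proof (rule tendsto_zero_powrI[OF tendsto_ident_at tendsto_const])
    show "\<forall>\<^sub>F r :: real in at_right 0. 0 \<le> r"
      by (rule eventually_at_rightI[of 0 1]) auto
  qed (use assms(2) in simp_all)
  then have "((\<lambda>r. root m (C * r powr (s * m - 1))) \<longlongrightarrow> root m (C * 0)) (at_right 0)"
    by (intro tendsto_real_root tendsto_mult_left)
  then have lim: "((\<lambda>r. ennreal (root m (C * r powr (s * m - 1)))) \<longlongrightarrow> 0) (at_right 0)"
    using tendsto_ennrealI[of _ 0] by simp
  have "hausdorff_premeasure s \<delta> (closure D) \<le> 0" if "0 < \<delta>" for \<delta>
  proof (rule tendsto_lowerbound[OF lim])
    show "\<forall>\<^sub>F r in at_right 0.
        hausdorff_premeasure s \<delta> (closure D) \<le> ennreal (root m (C * r powr (s * m - 1)))"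
      using that by (intro eventually_at_rightI[of 0 "min 1 (\<delta> / 2)"]) (auto intro: C)
  qed simp
  then have "hausdorff_measure s (closure D) \<le> 0" by (rule hausdorff_measure_le)
  then show ?thesis by simp
qed

lemma hausdorff_dim_eq_0I:
  assumes "\<And>s. 0 < s \<Longrightarrow> hausdorff_measure s A = 0"
  shows "hausdorff_dim A = 0"
proof -
  have "hausdorff_dim A \<le> 0 + ennreal s" if "0 < s" for s
    unfolding hausdorff_dim_def using that assms by (intro Inf_lower) auto
  then have "hausdorff_dim A \<le> 0" by (rule ennreal_le_epsilon)
  then show ?thesis by simp
qed

lemma diam_power_emeasure_cover:
  fixes U :: "'a::euclidean_space set"
  assumes "bounded U" "diameter U \<le> 1" "0 \<le> s" "s \<le> real DIM('a)"
  obtains V where "U \<subseteq> V" "V \<in> sets lborel"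
    "emeasure lborel V \<le> ennreal (unit_ball_vol DIM('a)) * diam_power s U"
proof (cases "U = {}")
  case True
  then show ?thesis using that[of "{}"] by simp
next
  case False
  then obtain x where "x \<in> U" by blast
  define d where "d = diameter U"
  have d: "0 \<le> d" "d \<le> 1" using assms(1,2) diameter_ge_0 by (auto simp: d_def)
  have "ennreal (d ^ DIM('a)) \<le> diam_power s U"
  proof (cases "d = 0")
    case True
    then show ?thesis by (simp add: zero_power)
  next
    case False
    then have "d ^ DIM('a) \<le> d powr s"
      using d assms(4) powr_mono'[of s "real DIM('a)" d] by (simp add: powr_realpow)
    then show ?thesis
      using \<open>U \<noteq> {}\<close> False d by (auto simp: diam_power_def d_def intro: ennreal_leI)
  qed
  then have "ennreal (unit_ball_vol DIM('a)) * ennreal (d ^ DIM('a)) \<le>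
      ennreal (unit_ball_vol DIM('a)) * diam_power s U"
    by (rule mult_left_mono) simp
  then have "emeasure lborel (cball x d) \<le> ennreal (unit_ball_vol DIM('a)) * diam_power s U"
    using d by (simp add: emeasure_cball ennreal_mult)
  moreover have "U \<subseteq> cball x d"
    using diameter_bounded_bound[OF assms(1) \<open>x \<in> U\<close>] by (auto simp: d_def)
  ultimately show ?thesis using that by simp
qed

lemma hausdorff_measure_eq_0_imp_null_sets:
  fixes S :: "'a::euclidean_space set"
  assumes "hausdorff_measure s S = 0" "0 \<le> s" "s \<le> real DIM('a)"
  shows "S \<in> null_sets lebesgue"
proof -
  let ?v = "unit_ball_vol DIM('a)"
  have "\<exists>T. S \<subseteq> T \<and> T \<in> lmeasurable \<and> measure lebesgue T \<le> e" if "0 < e" for e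
  proof -
    have "hausdorff_premeasure s 1 S \<le> 0"
      using hausdorff_premeasure_le_measure[of 1 s S] assms(1) by simp
    also have "0 < ennreal (e / ?v)" using \<open>0 < e\<close> by simp
    finally obtain U where U: "S \<subseteq> (\<Union>i::nat. U i)" "\<And>i. bounded (U i)"
      "\<And>i. diameter (U i) \<le> 1" "(\<Sum>i. diam_power s (U i)) < ennreal (e / ?v)"
      using hausdorff_premeasure_less_cover by blast
    have "\<exists>V. U i \<subseteq> V \<and> V \<in> sets lborel \<and>
        emeasure lborel V \<le> ennreal ?v * diam_power s (U i)" for i
      by (rule diam_power_emeasure_cover[OF U(2)[of i] U(3)[of i] assms(2,3)]) blast
    then obtain V where V: "\<And>i. U i \<subseteq> V i" "\<And>i. V i \<in> sets lborel"
      "\<And>i. emeasure lborel (V i) \<le> ennreal ?v * diam_power s (U i)"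
      by metis
    have "emeasure lborel (\<Union>i. V i) \<le> (\<Sum>i. emeasure lborel (V i))"
      using V(2) by (intro emeasure_subadditive_countably) auto
    also have "\<dots> \<le> (\<Sum>i. ennreal ?v * diam_power s (U i))"
      by (intro suminf_le V(3)) auto
    also have "\<dots> = ennreal ?v * (\<Sum>i. diam_power s (U i))" by simp
    also have "\<dots> \<le> ennreal ?v * ennreal (e / ?v)" using U(4) by (intro mult_left_mono) auto
    also have "\<dots> = ennreal e"
      using \<open>0 < e\<close> by (simp flip: ennreal_mult add: less_imp_neq[OF unit_ball_vol_pos, symmetric])
    finally have emeasure_le: "emeasure lebesgue (\<Union>i. V i) \<le> ennreal e" using V(2) by simp
    then have "(\<Union>i. V i) \<in> lmeasurable"
      using V(2) by (intro fmeasurableI) (auto intro: le_less_trans)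
    moreover from this have "measure lebesgue (\<Union>i. V i) \<le> e"
      using emeasure_le \<open>0 < e\<close> by (simp add: emeasure_eq_measure2)
    moreover have "S \<subseteq> (\<Union>i. V i)" using U(1) V(1) by blast
    ultimately show ?thesis by blast
  qed
  then show ?thesis by (simp add: negligible_outer_le flip: negligible_iff_null_sets)
qed

lemma hausdorff_dim_less_DIM_imp_null_sets:
  fixes S :: "'a::euclidean_space set"
  assumes "hausdorff_dim S < ennreal DIM('a)"
  shows "S \<in> null_sets lebesgue"
proof -
  obtain s where "0 \<le> s" "hausdorff_measure s S = 0" "ennreal s < ennreal DIM('a)"
    using assms unfolding hausdorff_dim_def Inf_less_iff by blast
  then show ?thesis
    by (intro hausdorff_measure_eq_0_imp_null_sets[of s]) (auto simp: ennreal_less_iff)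
qed

section \<open>Definable predicates\<close>

primrec rename_term :: "(nat \<Rightarrow> nat) \<Rightarrow> 'f fo_term \<Rightarrow> 'f fo_term" where
  "rename_term f (Var n) = Var (f n)"
| "rename_term f (Fun g ts) = Fun g (map (rename_term f) ts)"

primrec rename_formula :: "(nat \<Rightarrow> nat) \<Rightarrow> ('f, 'r) fo_formula \<Rightarrow> ('f, 'r) fo_formula" where
  "rename_formula f (Eq s t) = Eq (rename_term f s) (rename_term f t)"
| "rename_formula f (Rel r ts) = Rel r (map (rename_term f) ts)"
| "rename_formula f (Neg \<phi>) = Neg (rename_formula f \<phi>)"
| "rename_formula f (Conj \<phi> \<psi>) = Conj (rename_formula f \<phi>) (rename_formula f \<psi>)"
| "rename_formula f (Ex n \<phi>) = Ex (f n) (rename_formula f \<phi>)"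

lemma wf_term_rename_term [simp]: "wf_term M (rename_term f t) = wf_term M t"
  by (induction t) (auto simp: list_all_iff)

lemma wf_formula_rename_formula [simp]: "wf_formula M (rename_formula f \<phi>) = wf_formula M \<phi>"
  by (induction \<phi>) (auto simp: list_all_iff)

lemma term_val_rename_term [simp]: "term_val M v (rename_term f t) = term_val M (v \<circ> f) t"
  by (induction t) (auto intro!: arg_cong[where f = "fun_interp M _"])

lemma sat_rename_formula:
  assumes "inj f"
  shows "sat M v (rename_formula f \<phi>) = sat M (v \<circ> f) \<phi>"
proof (induction \<phi> arbitrary: v)
  case (Rel r ts)
  then show ?case by (auto intro!: arg_cong[where f = "rel_interp M r"] simp: comp_def)
next
  case (Ex n \<phi>)
  have "v(f n := a) \<circ> f = (v \<circ> f)(n := a)" for a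
    using assms by (auto simp: fun_eq_iff inj_eq)
  then show ?case by (simp only: rename_formula.simps sat.simps Ex)
qed auto

text \<open>The values \<open>u\<close> of the free variables and the values \<open>w\<close> of the parameters occupy disjoint
  infinite sets of positions, so there is always room to rename parameters apart.\<close>

definition valuation :: "(nat \<Rightarrow> 'a) \<Rightarrow> (nat \<Rightarrow> 'a) \<Rightarrow> nat \<Rightarrow> 'a" where
  "valuation u w i = case_sum u w (sum_decode i)"

lemma valuation_sum_encode [simp]: "valuation u w (sum_encode x) = case_sum u w x"
  by (simp add: valuation_def)

lemma valuation_fun_upd: "valuation (u(n := a)) w = (valuation u w)(sum_encode (Inl n) := a)"
  by (auto simp: fun_eq_iff valuation_def split: sum.split) (metis sum_decode_inverse)

definition rename_params :: "(nat \<Rightarrow> nat + nat) \<Rightarrow> nat \<Rightarrow> nat" where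
  "rename_params f = sum_encode \<circ> map_sum id (sum_encode \<circ> f) \<circ> sum_decode"

lemma inj_rename_params: "inj f \<Longrightarrow> inj (rename_params f)"
  unfolding rename_params_def
  by (intro inj_compose inj_sum_encode inj_sum_decode sum.inj_map inj_on_id)

lemma valuation_comp_rename_params:
  "valuation u (valuation w w') \<circ> rename_params f = valuation u (case_sum w w' \<circ> f)"
  by (auto simp: fun_eq_iff rename_params_def valuation_def[of u] split: sum.split)

definition definable_pred :: "('f, 'r, 'a) fo_structure \<Rightarrow> ((nat \<Rightarrow> 'a) \<Rightarrow> bool) \<Rightarrow> bool" where
  "definable_pred M P \<longleftrightarrow> (\<exists>\<phi> w. wf_formula M \<phi> \<and> (\<forall>u. P u \<longleftrightarrow> sat M (valuation u w) \<phi>))"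

definition definable_term :: "('f, 'r, 'a) fo_structure \<Rightarrow> ((nat \<Rightarrow> 'a) \<Rightarrow> 'a) \<Rightarrow> bool" where
  "definable_term M F \<longleftrightarrow> (\<exists>t w. wf_term M t \<and> (\<forall>u. F u = term_val M (valuation u w) t))"

lemma definable_predI:
  assumes "wf_formula M \<phi>" "\<And>u. P u \<longleftrightarrow> sat M (valuation u w) \<phi>"
  shows "definable_pred M P"
  using assms unfolding definable_pred_def by blast

lemma definable_predE:
  assumes "definable_pred M P"
  obtains \<phi> w where "wf_formula M \<phi>" "\<And>u. P u \<longleftrightarrow> sat M (valuation u w) \<phi>"
  using assms unfolding definable_pred_def by blast

lemma definable_pred_not: "definable_pred M P \<Longrightarrow> definable_pred M (\<lambda>u. \<not> P u)"
  unfolding definable_pred_def by (metis sat.simps(3) wf_formula.simps(3))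

lemma definable_pred_conj:
  assumes "definable_pred M P" "definable_pred M Q"
  shows "definable_pred M (\<lambda>u. P u \<and> Q u)"
proof -
  obtain \<phi> w where \<phi>: "wf_formula M \<phi>" "\<And>u. P u \<longleftrightarrow> sat M (valuation u w) \<phi>"
    using definable_predE[OF assms(1)] by blast
  obtain \<psi> w' where \<psi>: "wf_formula M \<psi>" "\<And>u. Q u \<longleftrightarrow> sat M (valuation u w') \<psi>"
    using definable_predE[OF assms(2)] by blast
  show ?thesis
  proof (rule definable_predI)
    let ?\<chi> = "Conj (rename_formula (rename_params Inl) \<phi>) (rename_formula (rename_params Inr) \<psi>)"
    show "wf_formula M ?\<chi>" using \<phi>(1) \<psi>(1) by simp
    show "P u \<and> Q u \<longleftrightarrow> sat M (valuation u (valuation w w')) ?\<chi>" for u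
      using \<phi>(2) \<psi>(2)
      by (simp add: sat_rename_formula inj_rename_params valuation_comp_rename_params
          case_sum_o_inj)
  qed
qed

lemma definable_pred_imp:
  assumes "definable_pred M P" "definable_pred M Q"
  shows "definable_pred M (\<lambda>u. P u \<longrightarrow> Q u)"
  using definable_pred_not[OF definable_pred_conj[OF assms(1) definable_pred_not[OF assms(2)]]]
  by simp

text \<open>The quantifier rules follow de Bruijn: below a quantifier, variable 0 is the bound one and
  the outer variables are shifted by one.\<close>

lemma definable_pred_ex:
  assumes "definable_pred M (\<lambda>u. Q (u 0) (\<lambda>i. u (Suc i)))"
  shows "definable_pred M (\<lambda>u. \<exists>a. Q a u)"
proof -
  obtain \<phi> w where \<phi>: "wf_formula M \<phi>"
    and Q: "\<And>u. Q (u 0) (\<lambda>i. u (Suc i)) \<longleftrightarrow> sat M (valuation u w) \<phi>"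
    using definable_predE[OF assms] by blast
  \<comment> \<open>The bound variable takes the place of parameter 0; all others move by one to make room.\<close>
  define f where "f = sum_encode \<circ> case_sum (case_nat (Inr 0) Inl) (Inr \<circ> Suc) \<circ> sum_decode"
  have "inj (case_sum (case_nat (Inr 0) Inl) (Inr \<circ> Suc) :: nat + nat \<Rightarrow> nat + nat)"
    by (rule injI) (auto split: sum.splits nat.splits)
  then have f: "inj f"
    unfolding f_def by (intro inj_compose inj_sum_encode inj_sum_decode)
  have "(valuation u (case_nat b w))(sum_encode (Inr 0) := a) \<circ> f = valuation (case_nat a u) w"
    for u a b
    by (auto simp: fun_eq_iff f_def valuation_def[of "case_nat a u"] sum_encode_eq
        split: sum.split nat.split)
  then have "(\<exists>a. Q a u) \<longleftrightarrow>
      sat M (valuation u (case_nat undefined w)) (Ex (sum_encode (Inr 0)) (rename_formula f \<phi>))"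
    for u
    using Q[of "case_nat a u" for a] by (simp add: sat_rename_formula f)
  moreover have "wf_formula M (Ex (sum_encode (Inr 0)) (rename_formula f \<phi>))" using \<phi> by simp
  ultimately show ?thesis by (rule definable_predI[rotated])
qed

lemma definable_pred_all:
  assumes "definable_pred M (\<lambda>u. Q (u 0) (\<lambda>i. u (Suc i)))"
  shows "definable_pred M (\<lambda>u. \<forall>a. Q a u)"
  using definable_pred_not[OF definable_pred_ex[OF definable_pred_not[OF assms]]] by simp

lemma definable_pred_mem:
  assumes "definable M S"
  shows "definable_pred M (\<lambda>u. u i \<in> S)"
proof -
  obtain \<phi> v where \<phi>: "wf_formula M \<phi>" "S = {x. sat M (v(0 := x)) \<phi>}"
    using assms unfolding definable_def by blast
  define f where "f = sum_encode \<circ> case_nat (Inl i) Inr"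
  have "inj (case_nat (Inl i) Inr :: nat \<Rightarrow> nat + nat)"
    by (rule injI) (auto split: nat.splits)
  then have "inj f" unfolding f_def by (intro inj_compose inj_sum_encode)
  moreover have "valuation u (\<lambda>k. v (Suc k)) \<circ> f = v(0 := u i)" for u
    by (auto simp: fun_eq_iff f_def split: nat.splits)
  ultimately show ?thesis
    using \<phi>
    by (intro definable_predI[where \<phi> = "rename_formula f \<phi>" and w = "\<lambda>k. v (Suc k)"])
      (auto simp: sat_rename_formula)
qed

lemma definable_pred_bex:
  assumes "definable M S" "definable_pred M (\<lambda>u. Q (u 0) (\<lambda>i. u (Suc i)))"
  shows "definable_pred M (\<lambda>u. \<exists>a\<in>S. Q a u)"
  unfolding Bex_def by (intro definable_pred_ex definable_pred_conj definable_pred_mem assms)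

lemma definable_Collect:
  assumes "definable_pred M (\<lambda>u. P (u 0))"
  shows "definable M {x. P x}"
proof -
  obtain \<phi> w where \<phi>: "wf_formula M \<phi>" "\<And>u. P (u 0) \<longleftrightarrow> sat M (valuation u w) \<phi>"
    using definable_predE[OF assms] by blast
  have "valuation (undefined(0 := x)) w = (valuation undefined w)(0 := x)" for x
    by (simp add: valuation_fun_upd sum_encode_def)
  then have "{x. P x} = {x. sat M ((valuation undefined w)(0 := x)) \<phi>}"
    using \<phi>(2)[of "undefined(0 := x)" for x] by simp
  with \<phi>(1) show ?thesis unfolding definable_def by blast
qed

lemma definable_Int:
  assumes "definable M S" "definable M T"
  shows "definable M (S \<inter> T)"
  unfolding Int_def
  by (intro definable_Collect definable_pred_conj definable_pred_mem assms)

lemma definable_Diff: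
  assumes "definable M S" "definable M T"
  shows "definable M (S - T)"
  unfolding set_diff_eq
  by (intro definable_Collect definable_pred_conj definable_pred_not definable_pred_mem assms)

lemma definable_term_var: "definable_term M (\<lambda>u. u i)"
  unfolding definable_term_def
  by (intro exI[of _ "Var (sum_encode (Inl i))"]) simp

lemma definable_term_const: "definable_term M (\<lambda>u. c)"
  unfolding definable_term_def
  by (intro exI[of _ "Var (sum_encode (Inr 0))"] exI[of _ "\<lambda>_. c"]) simp

lemma definable_terms_common_params:
  assumes "list_all (definable_term M) Fs"
  obtains ts w where "list_all (wf_term M) ts"
    "\<And>u. map (\<lambda>F. F u) Fs = map (term_val M (valuation u w)) ts"
  using assms
proof (induction Fs arbitrary: thesis)
  case Nil
  show ?case by (rule Nil(1)[of "[]"]) auto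
next
  case (Cons F Fs)
  obtain t w where t: "wf_term M t" "\<And>u. F u = term_val M (valuation u w) t"
    using Cons.prems(2) unfolding definable_term_def by auto
  obtain ts w' where ts: "list_all (wf_term M) ts"
    "\<And>u. map (\<lambda>F. F u) Fs = map (term_val M (valuation u w')) ts"
    using Cons.IH Cons.prems(2) by auto
  let ?ts = "rename_term (rename_params Inl) t # map (rename_term (rename_params Inr)) ts"
  show ?case
  proof (rule Cons.prems(1))
    show "list_all (wf_term M) ?ts" using t(1) ts(1) by (simp add: list.pred_map comp_def)
    show "map (\<lambda>F. F u) (F # Fs) = map (term_val M (valuation u (valuation w w'))) ?ts" for u
      using t(2) ts(2)[of u] by (simp add: valuation_comp_rename_params case_sum_o_inj)
  qed
qed

lemma definable_term_fun:
  assumes "length Fs = fun_arity M f" "list_all (definable_term M) Fs"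
  shows "definable_term M (\<lambda>u. fun_interp M f (map (\<lambda>F. F u) Fs))"
proof -
  obtain ts w where ts: "list_all (wf_term M) ts"
    "\<And>u. map (\<lambda>F. F u) Fs = map (term_val M (valuation u w)) ts"
    using definable_terms_common_params[OF assms(2)] by blast
  then have "length ts = fun_arity M f" using assms(1) map_eq_imp_length_eq by metis
  with ts show ?thesis unfolding definable_term_def
    by (intro exI[of _ "Fun f ts"] exI[of _ w]) simp
qed

lemma definable_pred_rel:
  assumes "length Fs = rel_arity M r" "list_all (definable_term M) Fs"
  shows "definable_pred M (\<lambda>u. rel_interp M r (map (\<lambda>F. F u) Fs))"
proof -
  obtain ts w where ts: "list_all (wf_term M) ts"
    "\<And>u. map (\<lambda>F. F u) Fs = map (term_val M (valuation u w)) ts"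
    using definable_terms_common_params[OF assms(2)] by blast
  then have "length ts = rel_arity M r" using assms(1) map_eq_imp_length_eq by metis
  with ts show ?thesis by (intro definable_predI[of M "Rel r ts"]) auto
qed

lemma definable_pred_eq:
  assumes "definable_term M F" "definable_term M G"
  shows "definable_pred M (\<lambda>u. F u = G u)"
proof -
  obtain ts w where ts: "list_all (wf_term M) ts"
    "\<And>u. map (\<lambda>F. F u) [F, G] = map (term_val M (valuation u w)) ts"
    using definable_terms_common_params[of M "[F, G]"] assms by auto
  from ts(2)[of undefined] obtain s t where "ts = [s, t]" by auto
  with ts show ?thesis by (intro definable_predI[of M "Eq s t"]) auto
qed

section \<open>Definable sets in expansions of the real field\<close>

locale real_field_expansion =
  fixes M :: "('f, 'r, real) fo_structure"
  assumes expands_real_field: "expands_real_field M"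
begin

lemma definable_term_add:
  assumes "definable_term M F" "definable_term M G"
  shows "definable_term M (\<lambda>u. F u + G u)"
proof -
  obtain p where "fun_arity M p = 2" "\<And>x y. fun_interp M p [x, y] = x + y"
    using expands_real_field unfolding expands_real_field_def by blast
  then show ?thesis using definable_term_fun[of "[F, G]" M p] assms by simp
qed

lemma definable_term_mult:
  assumes "definable_term M F" "definable_term M G"
  shows "definable_term M (\<lambda>u. F u * G u)"
proof -
  obtain p where "fun_arity M p = 2" "\<And>x y. fun_interp M p [x, y] = x * y"
    using expands_real_field unfolding expands_real_field_def by blast
  then show ?thesis using definable_term_fun[of "[F, G]" M p] assms by simp
qed

lemma definable_pred_less:
  assumes "definable_term M F" "definable_term M G"
  shows "definable_pred M (\<lambda>u. F u < G u)"
proof -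
  obtain l where "rel_arity M l = 2" "\<And>x y. rel_interp M l [x, y] \<longleftrightarrow> x < y"
    using expands_real_field unfolding expands_real_field_def by blast
  then show ?thesis using definable_pred_rel[of "[F, G]" M l] assms by simp
qed

lemmas definable_intros = definable_pred_not definable_pred_conj definable_pred_imp
  definable_pred_ex definable_pred_all definable_pred_bex
  definable_pred_mem definable_pred_less definable_pred_eq
  definable_term_var definable_term_const definable_term_add definable_term_mult

lemma definable_greaterThanLessThan: "definable M {a<..<b}"
proof -
  have "{a<..<b} = {x. a < x \<and> x < b}" by auto
  then show ?thesis by (simp only:) (intro definable_Collect definable_intros)
qed

lemma definable_atLeastAtMost: "definable M {a..b}"
proof -
  have "{a..b} = {x. \<not> x < a \<and> \<not> b < x}" by auto
  then show ?thesis by (simp only:) (intro definable_Collect definable_intros)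
qed

lemma definable_closure:
  assumes "definable M S"
  shows "definable M (closure S)"
proof -
  have "closure S = {x. \<forall>a b. a < x \<and> x < b \<longrightarrow> (\<exists>s\<in>S. a < s \<and> s < b)}"
  proof (intro equalityI subsetI CollectI allI impI)
    fix x a b assume "x \<in> closure S" and "a < x \<and> x < b"
    then have "{a<..<b} \<inter> closure S \<noteq> {}" by auto
    then show "\<exists>s\<in>S. a < s \<and> s < b"
      by (auto simp: open_Int_closure_eq_empty)
  next
    fix x assume "x \<in> {x. \<forall>a b. a < x \<and> x < b \<longrightarrow> (\<exists>s\<in>S. a < s \<and> s < b)}"
    then have "\<exists>s\<in>S. x - e < s \<and> s < x + e" if "0 < e" for e using that by simp
    then have "\<exists>s\<in>S. dist s x < e" if "0 < e" for e
      using that by (force simp: dist_real_def abs_less_iff)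
    then show "x \<in> closure S" by (simp add: closure_approachable)
  qed
  then show ?thesis by (simp only:) (intro definable_Collect definable_intros assms)
qed

lemma definable_left_isolated:
  assumes "definable M S"
  shows "definable M (left_isolated S)"
proof -
  have "left_isolated S = {x. x \<in> S \<and> (\<exists>y. y < x \<and> \<not> (\<exists>z\<in>S. y < z \<and> z < x))}"
    by (fastforce simp: left_isolated_def disjoint_iff)
  then show ?thesis by (simp only:) (intro definable_Collect definable_intros assms)
qed

lemma definable_difference_quotients:
  assumes "definable M D"
  shows "definable M (difference_quotients D)"
proof -
  have "q = (a - b) / (c - d) \<longleftrightarrow> q * c + b = q * d + a" if "c \<noteq> d" for a b c d q :: real
    using that by (simp add: eq_divide_eq algebra_simps)
  then have "difference_quotients D =
      {q. \<exists>a\<in>D. \<exists>b\<in>D. \<exists>c\<in>D. \<exists>d\<in>D. \<not> c = d \<and> q * c + b = q * d + a}"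
    unfolding difference_quotients_def by (simp cong: conj_cong)
  then show ?thesis by (simp only:) (intro definable_Collect definable_intros assms)
qed

lemma definable_image_diff_scaled:
  assumes "definable M D"
  shows "definable M ((\<lambda>(a, b). a - t * b) ` (D \<times> D))"
proof -
  have "(\<lambda>(a, b). a - t * b) ` (D \<times> D) = {x. \<exists>a\<in>D. \<exists>b\<in>D. x + t * b = a}"
    by (force simp: image_iff algebra_simps)
  then show ?thesis by (simp only:) (intro definable_Collect definable_intros assms)
qed

end

section \<open>i-minimal expansions\<close>

lemma interior_countable_eq_empty:
  fixes D :: "'a::euclidean_space set"
  assumes "countable D"
  shows "interior D = {}"
proof (rule ccontr)
  assume "interior D \<noteq> {}"
  then obtain x e where "0 < e" "ball x e \<subseteq> D" by (metis ex_in_conv mem_interior)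
  then show False using assms countable_subset uncountable_ball by blast
qed

lemma i_minimal_imp_interior_closure_eq_empty:
  assumes "i_minimal M" "definable M S" "interior S = {}"
  shows "interior (closure S) = {}"
  using assms unfolding i_minimal_def nowhere_dense_def by blast

lemma i_minimal_countable_closure_neq_UNIV:
  assumes "i_minimal M" "definable M D" "countable D"
  shows "closure D \<noteq> UNIV"
  using i_minimal_imp_interior_closure_eq_empty[OF assms(1,2)]
    interior_countable_eq_empty[OF assms(3)] by auto

context real_field_expansion
begin

lemma i_minimal_imp_packing_bounded:
  assumes "i_minimal M" "definable M D" "countable D" "bounded D"
  shows "packing_bounded (2 ^ k) D"
  using assms(2-4)
proof (induction k arbitrary: D)
  case 0
  then show ?case using packing_bounded_1 by simp
next
  case (Suc k)
  have "closure (difference_quotients D) \<noteq> UNIV"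
    using Suc.prems by (intro i_minimal_countable_closure_neq_UNIV[OF assms(1)]
        definable_difference_quotients countable_difference_quotients)
  then obtain t where "t \<notin> closure (difference_quotients D)" by blast
  moreover have "packing_bounded (2 ^ k) ((\<lambda>(a, b). a - t * b) ` (D \<times> D))"
    using Suc.prems
    by (intro Suc.IH definable_image_diff_scaled countable_image countable_SIGMA
        bounded_image_diff_scaled)
  ultimately show ?case using packing_bounded_double by simp
qed

lemma i_minimal_imp_hausdorff_measure_eq_0:
  assumes "i_minimal M" "definable M K" "compact K" "interior K = {}" "0 < s"
  shows "hausdorff_measure s K = 0"
proof -
  obtain k where "1 / s < 2 ^ k" using real_arch_pow[of 2 "1 / s"] by auto
  then have "1 < s * real (2 ^ k)" using assms(5) by (simp add: field_simps)
  moreover have "packing_bounded (2 ^ k) (left_isolated K)"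
    using assms(2,3) bounded_subset[OF compact_imp_bounded left_isolated_subset]
    by (intro i_minimal_imp_packing_bounded[OF assms(1)] definable_left_isolated
        countable_left_isolated)
  ultimately have "hausdorff_measure s (closure (left_isolated K)) = 0"
    by (intro packing_bounded_imp_hausdorff_measure_closure_eq_0)
  moreover have "K \<subseteq> closure (left_isolated K)"
    using assms(3,4) by (intro closed_subset_closure_left_isolated compact_imp_closed)
  ultimately show ?thesis using hausdorff_measure_mono by (metis le_zero_eq)
qed

lemma i_minimal_imp_hausdorff_dim_eq_0:
  assumes "i_minimal M" "definable M S" "interior S = {}"
  shows "hausdorff_dim S = 0"
proof (rule hausdorff_dim_eq_0I)
  fix s :: real assume "0 < s"
  define K where "K n = closure S \<inter> {- real n..real n}" for n
  have "interior (closure S) = {}"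
    using assms by (rule i_minimal_imp_interior_closure_eq_empty)
  then have "hausdorff_measure s (K n) = 0" for n
    unfolding K_def using assms(1,2) \<open>0 < s\<close>
    by (intro i_minimal_imp_hausdorff_measure_eq_0 definable_Int definable_closure
        definable_atLeastAtMost closed_Int_compact) auto
  then have "hausdorff_measure s (\<Union>n. K n) = 0"
    using hausdorff_measure_UN_le[of s K] by simp
  moreover have "S \<subseteq> (\<Union>n. K n)"
  proof
    fix x assume "x \<in> S"
    moreover obtain n where "\<bar>x\<bar> \<le> real n" using real_arch_simple by blast
    ultimately have "x \<in> K n" using closure_subset by (auto simp: K_def)
    then show "x \<in> (\<Union>n. K n)" by blast
  qed
  ultimately show "hausdorff_measure s S = 0" using hausdorff_measure_mono by (metis le_zero_eq)
qed

lemma i_minimalI_null_sets: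
  assumes "\<And>S. definable M S \<Longrightarrow> interior S = {} \<Longrightarrow> S \<in> null_sets lebesgue"
  shows "i_minimal M"
  unfolding i_minimal_def nowhere_dense_def
proof (intro allI impI disjCI, rule ccontr)
  fix S assume S: "definable M S" "\<not> interior S \<noteq> {}" and "interior (closure S) \<noteq> {}"
  then obtain x e where "0 < e" "ball x e \<subseteq> closure S" by (metis ex_in_conv mem_interior)
  then obtain a b where ab: "a < b" "{a<..<b} \<subseteq> closure S"
    by (auto simp: ball_eq_greaterThanLessThan intro: that[of "x - e" "x + e"])
  have "interior ({a<..<b} - S) = {}" using ab(2) by (simp add: interior_diff)
  then have "{a<..<b} - S \<in> null_sets lebesgue"
    by (intro assms definable_Diff definable_greaterThanLessThan S(1))
  moreover have "S \<in> null_sets lebesgue" using assms S by blast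
  ultimately have "negligible ({a<..<b} - S \<union> S)"
    unfolding negligible_iff_null_sets by (rule null_sets.Un)
  then have "negligible {a<..<b}" by (rule negligible_subset) auto
  then show False using ab(1) open_not_negligible[of "{a<..<b}"] by simp
qed

end

theorem theorem1p1:
  fixes M :: "('f, 'r, real) fo_structure"
  assumes "expands_real_field M"
  shows "(i_minimal M \<longleftrightarrow>
            (\<forall>S. definable M S \<longrightarrow> interior S \<noteq> {} \<or> S \<in> null_sets lebesgue)) \<and>
         ((\<forall>S. definable M S \<longrightarrow> interior S \<noteq> {} \<or> S \<in> null_sets lebesgue) \<longleftrightarrow>
            (\<forall>S. definable M S \<longrightarrow> interior S \<noteq> {} \<or> hausdorff_dim S = 0))"
  (is "(_ \<longleftrightarrow> ?null) \<and> (_ \<longleftrightarrow> ?dim)")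
proof -
  interpret real_field_expansion M using assms by unfold_locales
  have "i_minimal M" if ?null using i_minimalI_null_sets that by blast
  moreover have ?dim if "i_minimal M" using i_minimal_imp_hausdorff_dim_eq_0 that by blast
  moreover have ?null if ?dim
    using hausdorff_dim_less_DIM_imp_null_sets[where 'a = real] that by force
  ultimately show ?thesis by argo
qed

end
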